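(* Let $1\le \ell<k$. Let $\mathcal H$ be the (infinite) family of all $\ell$-uneven $k$-edge hypergraphs. Then $f(m,\mathcal H)\to\infty$ as $m\to\infty$. Conversely, if $\mathcal H$ is the family of all even $k$-edge hypergraphs, we have $f(m,\mathcal H)=k-1$.
   Context: A hypergraph $H$ on a finite vertex set $V(H)$ is a subset of $2^{V(H)}$; its elements are its edges, $|F|$ denotes the number of edges of $F$, and a subgraph of $F$ is given by a subset of its edges. For a family $\mathcal H$ of hypergraphs, a hypergraph $F$ is $\mathcal H$-free if it contains no copy of any member of $\mathcal H$ as a (not necessarily induced) subgraph. Let $\mathrm{ex}(F,\mathcal H)$ be the maximum number of edges of an $\mathcal H$-free subgraph of $F$, and $f(m,\mathcal H):=\min_{|F|=m}\mathrm{ex}(F,\mathcal H)$, the minimum being over all hypergraphs $F$ with $m$ edges (not necessarily uniform). A $k$-edge hypergraph is a hypergraph with $k$ edges. A $k$-edge hypergraph $\{A_1,\dots,A_k\}$ is even if for every $1\le \ell\le k$ and for every $I,J\in\binom{[k]}{\ell}$, $\bigcap_{i\in I}A_i=\varnothing\iff\bigcap_{j\in J}A_j=\varnothing$. It is $\ell$-uneven if there exist $I,J\in\binom{[k]}{\ell}$ such that $\bigcap_{i\in I}A_i\ne\varnothing$ but $\bigcap_{j\in J}A_j=\varnothing$.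
   Formalization: The equality f(m,H) = k-1 for the even family is stated for all m ≥ k-1; for m < k-1 it fails, since a hypergraph with m < k edges contains no k-edge hypergraph and so f(m,H) = m. *)

theory Defs
  imports Complex_Main
begin

datatype 'a hypergraph = Hypergraph (verts: "'a set") (edges: "'a set set")

definition wf_hypergraph :: "'a hypergraph \<Rightarrow> bool" where
  "wf_hypergraph H \<longleftrightarrow> finite (verts H) \<and> edges H \<subseteq> Pow (verts H)"

definition contains_copy :: "'a hypergraph \<Rightarrow> 'b hypergraph \<Rightarrow> bool" where
  "contains_copy F H \<longleftrightarrow>
    (\<exists>\<phi>. inj_on \<phi> (verts H) \<and> \<phi> ` verts H \<subseteq> verts F \<and> (\<forall>e\<in>edges H. \<phi> ` e \<in> edges F))"

definition free_of :: "'b hypergraph set \<Rightarrow> 'a hypergraph \<Rightarrow> bool" where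
  "free_of \<H> F \<longleftrightarrow> (\<forall>H\<in>\<H>. \<not> contains_copy F H)"

definition ex_num :: "'a hypergraph \<Rightarrow> 'b hypergraph set \<Rightarrow> nat" where
  "ex_num F \<H> = Max {card E | E. E \<subseteq> edges F \<and> free_of \<H> (Hypergraph (verts F) E)}"

text \<open>Every finite hypergraph is isomorphic to one with vertices in \<open>nat\<close>, so the minimum over
  all hypergraphs with \<open>m\<close> edges may be taken over these. There is such a hypergraph for
  every \<open>m\<close>, hence the infimum of this set of natural numbers is its minimum.\<close>

definition f_min :: "nat \<Rightarrow> 'b hypergraph set \<Rightarrow> nat" where
  "f_min m \<H> = Inf {ex_num F \<H> | F :: nat hypergraph. wf_hypergraph F \<and> card (edges F) = m}"

text \<open>The edges are pairwise distinct, so index sets of size \<open>l\<close> correspond to sets of \<open>l\<close> edges.\<close>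

definition even_hypergraph :: "nat \<Rightarrow> 'a hypergraph \<Rightarrow> bool" where
  "even_hypergraph k H \<longleftrightarrow> wf_hypergraph H \<and> card (edges H) = k \<and>
    (\<forall>l\<in>{1..k}. \<forall>I J. I \<subseteq> edges H \<and> card I = l \<and> J \<subseteq> edges H \<and> card J = l \<longrightarrow>
      (\<Inter>I = {} \<longleftrightarrow> \<Inter>J = {}))"

definition uneven_hypergraph :: "nat \<Rightarrow> nat \<Rightarrow> 'a hypergraph \<Rightarrow> bool" where
  "uneven_hypergraph l k H \<longleftrightarrow> wf_hypergraph H \<and> card (edges H) = k \<and>
    (\<exists>I J. I \<subseteq> edges H \<and> card I = l \<and> J \<subseteq> edges H \<and> card J = l \<and> \<Inter>I \<noteq> {} \<and> \<Inter>J = {})"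

end

theory Submission
  imports Defs "HOL-Library.Ramsey"
begin

text \<open>
  Whether a nonempty set of edges has a common vertex is preserved by an injective relabelling of
  the vertices (\<open>Inter_image_image\<close>). So a copy of an \<open>l\<close>-uneven hypergraph inside a set \<open>E\<close> of edges
  exhibits two \<open>l\<close>-subsets of \<open>E\<close>, one with empty and one with nonempty intersection. Colour each
  \<open>l\<close>-subset of the edges of \<open>F\<close> by whether its intersection is empty. If \<open>F\<close> has enough edges,
  Ramsey's theorem yields \<open>N\<close> of them all of whose \<open>l\<close>-subsets have the same colour
  (\<open>Ramsey_empty_intersections\<close>), and these \<open>N\<close> edges contain no \<open>l\<close>-uneven hypergraph
  (\<open>free_of_uneven_if_monochromatic\<close>). Hence the extremal number of \<open>F\<close> is at least \<open>N\<close>, with a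
  threshold on the number of edges that does not depend on \<open>F\<close>.

  For even hypergraphs, \<open>k - 1\<close> edges never contain a \<open>k\<close>-edge hypergraph, which is the lower bound.
  It is attained by \<open>m\<close> distinct singletons: the edges are nonempty and any two of them are disjoint,
  so whether an intersection is empty depends only on the number of edges intersected, and any \<open>k\<close>
  of the singletons form an even hypergraph.
\<close>

section \<open>Copies of hypergraphs\<close>

text \<open>For empty \<open>I\<close> both intersections would be the whole type, and \<open>\<phi>\<close> need not be surjective.\<close>

lemma Inter_image_image:
  assumes "inj_on \<phi> V" and "I \<subseteq> Pow V" and "I \<noteq> {}"
  shows "\<Inter> ((`) \<phi> ` I) = \<phi> ` \<Inter>I"
proof -
  obtain A where "A \<in> I" using assms(3) by blast
  then show ?thesis
    using image_INT[of \<phi> V I "\<lambda>x. x" A] assms by auto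
qed

lemma inj_on_image_edges:
  assumes "wf_hypergraph H" and "inj_on \<phi> (verts H)"
  shows "inj_on ((`) \<phi>) (edges H)"
  using assms inj_on_subset[OF inj_on_image_Pow] unfolding wf_hypergraph_def by blast

lemma finite_edges: "wf_hypergraph H \<Longrightarrow> finite (edges H)"
  unfolding wf_hypergraph_def using finite_subset[of "edges H" "Pow (verts H)"] by simp

lemma contains_copy_card_le:
  assumes "wf_hypergraph H" and "contains_copy F H" and "finite (edges F)"
  shows "card (edges H) \<le> card (edges F)"
proof -
  obtain \<phi> where "inj_on \<phi> (verts H)" and "(`) \<phi> ` edges H \<subseteq> edges F"
    using assms(2) unfolding contains_copy_def by blast
  then show ?thesis
    using inj_on_image_edges[OF assms(1)] assms(3) card_inj_on_le[of "(`) \<phi>"] by blast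
qed

text \<open>The images of the two \<open>l\<close>-sets that witness unevenness are again \<open>l\<close>-sets of edges, and their
  intersections are empty or not as before. The hypothesis \<open>1 \<le> l\<close> makes the two sets nonempty, as
  \<open>Inter_image_image\<close> requires.\<close>

lemma free_of_uneven_if_monochromatic:
  assumes "1 \<le> l"
    and mono: "\<And>I J. \<lbrakk>I \<subseteq> edges F; card I = l; J \<subseteq> edges F; card J = l\<rbrakk> \<Longrightarrow>
      \<Inter>I = {} \<longleftrightarrow> \<Inter>J = {}"
  shows "free_of {H. uneven_hypergraph l k H} F"
  unfolding free_of_def
proof clarify
  fix H :: "'b hypergraph"
  assume "uneven_hypergraph l k H" and "contains_copy F H"
  then obtain I J where wf: "wf_hypergraph H"
    and I: "I \<subseteq> edges H" "card I = l" "\<Inter>I \<noteq> {}"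
    and J: "J \<subseteq> edges H" "card J = l" "\<Inter>J = {}"
    unfolding uneven_hypergraph_def by metis
  obtain \<phi> where \<phi>: "inj_on \<phi> (verts H)" "(`) \<phi> ` edges H \<subseteq> edges F"
    using \<open>contains_copy F H\<close> unfolding contains_copy_def by blast
  have copy: "(`) \<phi> ` K \<subseteq> edges F \<and> card ((`) \<phi> ` K) = l \<and>
      (\<Inter> ((`) \<phi> ` K) = {} \<longleftrightarrow> \<Inter>K = {})"
    if K: "K \<subseteq> edges H" "card K = l" for K
  proof -
    have "K \<noteq> {}" "K \<subseteq> Pow (verts H)"
      using K wf \<open>1 \<le> l\<close> unfolding wf_hypergraph_def by auto
    then have "\<Inter> ((`) \<phi> ` K) = \<phi> ` \<Inter>K"
      using Inter_image_image[OF \<phi>(1)] by blast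
    moreover have "inj_on ((`) \<phi>) K"
      using inj_on_image_edges[OF wf \<phi>(1)] K(1) inj_on_subset by blast
    ultimately show ?thesis
      using K \<phi>(2) image_mono[OF K(1), of "(`) \<phi>"] by (simp add: card_image subset_trans)
  qed
  have "\<Inter> ((`) \<phi> ` I) = {} \<longleftrightarrow> \<Inter> ((`) \<phi> ` J) = {}"
    using copy[OF I(1,2)] copy[OF J(1,2)] by (intro mono) simp_all
  then show False
    using copy[OF I(1,2)] copy[OF J(1,2)] I(3) J(3) by simp
qed

section \<open>Extremal numbers\<close>

lemma finite_free_cards:
  assumes "wf_hypergraph F"
  shows "finite {card E | E. E \<subseteq> edges F \<and> P E}"
proof -
  have "{card E | E. E \<subseteq> edges F \<and> P E} \<subseteq> card ` Pow (edges F)" by blast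
  then show ?thesis using finite_edges[OF assms] finite_subset by blast
qed

lemma card_le_ex_num:
  assumes "wf_hypergraph F" and "E \<subseteq> edges F" and "free_of \<H> (Hypergraph (verts F) E)"
  shows "card E \<le> ex_num F \<H>"
  unfolding ex_num_def using assms by (intro Max_ge finite_free_cards) auto

lemma free_of_few_edges:
  assumes "\<And>H. H \<in> \<H> \<Longrightarrow> wf_hypergraph H \<and> card (edges H) = k"
    and "finite (edges F)" and "card (edges F) < k"
  shows "free_of \<H> F"
  unfolding free_of_def
proof
  fix H assume "H \<in> \<H>"
  then show "\<not> contains_copy F H"
    using assms(1)[of H] assms(2,3) contains_copy_card_le[of H F] by auto
qed

text \<open>The hypothesis \<open>0 < k\<close> makes the empty set of edges free of the family, so that the maximum
  is taken over a nonempty set.\<close>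

lemma ex_num_le:
  assumes wf: "wf_hypergraph F" and "0 < k"
    and \<H>: "\<And>H. H \<in> \<H> \<Longrightarrow> wf_hypergraph H \<and> card (edges H) = k"
    and bound: "\<And>E. \<lbrakk>E \<subseteq> edges F; free_of \<H> (Hypergraph (verts F) E)\<rbrakk> \<Longrightarrow> card E \<le> N"
  shows "ex_num F \<H> \<le> N"
proof -
  have "free_of \<H> (Hypergraph (verts F) {})"
    using free_of_few_edges[where F = "Hypergraph (verts F) {}", OF \<H>] \<open>0 < k\<close> by simp
  then have "{card E | E. E \<subseteq> edges F \<and> free_of \<H> (Hypergraph (verts F) E)} \<noteq> {}"
    by blast
  then show ?thesis
    unfolding ex_num_def using finite_free_cards[OF wf] bound by (subst Max_le_iff) auto
qed

text \<open>This hypergraph is extremal for the even family, and it also witnesses that hypergraphs with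
  \<open>m\<close> edges exist.\<close>

definition singleton_matching :: "nat \<Rightarrow> nat hypergraph" where
  "singleton_matching m = Hypergraph {..<m} ((\<lambda>i. {i}) ` {..<m})"

lemma wf_singleton_matching: "wf_hypergraph (singleton_matching m)"
  unfolding singleton_matching_def wf_hypergraph_def by auto

lemma card_singleton_matching: "card (edges (singleton_matching m)) = m"
  unfolding singleton_matching_def by (simp add: card_image)

lemma f_min_le:
  fixes F :: "nat hypergraph"
  assumes "wf_hypergraph F" and "card (edges F) = m"
  shows "f_min m \<H> \<le> ex_num F \<H>"
  unfolding f_min_def using assms by (intro cInf_lower bdd_below_bot) blast

text \<open>The infimum of the empty set of naturals is \<open>0\<close>, so a lower bound needs some hypergraph with
  \<open>m\<close> edges to exist; the matching is one.\<close>

lemma le_f_min: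
  assumes "\<And>F :: nat hypergraph. \<lbrakk>wf_hypergraph F; card (edges F) = m\<rbrakk> \<Longrightarrow> N \<le> ex_num F \<H>"
  shows "N \<le> f_min m \<H>"
  unfolding f_min_def
  using assms wf_singleton_matching card_singleton_matching by (intro cInf_greatest) blast+

section \<open>Uneven hypergraphs\<close>

text \<open>Ramsey's theorem for the two-colouring of the \<open>l\<close>-subsets of a set system by whether they
  have a common point, transferred along an enumeration of the system.\<close>

lemma Ramsey_empty_intersections:
  "\<exists>M. \<forall>\<E> :: 'a set set. finite \<E> \<and> M \<le> card \<E> \<longrightarrow> (\<exists>E\<subseteq>\<E>. card E = N \<and>
    (\<forall>I J. I \<subseteq> E \<and> card I = l \<and> J \<subseteq> E \<and> card J = l \<longrightarrow> (\<Inter>I = {} \<longleftrightarrow> \<Inter>J = {})))"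
proof -
  obtain M :: nat where M: "partn_lst {..<M} [N, N] l"
    using ramsey_full by blast
  have "\<exists>E\<subseteq>\<E>. card E = N \<and>
    (\<forall>I J. I \<subseteq> E \<and> card I = l \<and> J \<subseteq> E \<and> card J = l \<longrightarrow> (\<Inter>I = {} \<longleftrightarrow> \<Inter>J = {}))"
    if fin: "finite \<E>" and "M \<le> card \<E>" for \<E> :: "'a set set"
  proof -
    obtain g where g: "bij_betw g {..<card \<E>} \<E>"
      using ex_bij_betw_nat_finite[OF fin] by (auto simp: lessThan_atLeast0)
    define c :: "nat set \<Rightarrow> nat" where "c X = (if \<Inter> (g ` X) = {} then 0 else 1)" for X
    have "c \<in> nsets {..<card \<E>} l \<rightarrow> {..<2}"
      by (auto simp: c_def)
    then obtain i H where "i < Suc (Suc 0)" and H: "H \<in> nsets {..<card \<E>} ([N, N] ! i)"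
      and c: "c ` nsets H l \<subseteq> {i}"
      using partn_lstE[OF partn_lst_greater_resource[OF M \<open>M \<le> card \<E>\<close>], of c 2]
      by auto
    then have H: "H \<subseteq> {..<card \<E>}" "finite H" "card H = N"
      by (auto simp: nsets_def less_Suc_eq)
    then have inj: "inj_on g H" and sub: "g ` H \<subseteq> \<E>"
      using g inj_on_subset unfolding bij_betw_def by blast+
    have colour: "\<Inter>I = {} \<longleftrightarrow> i = 0" if I: "I \<subseteq> g ` H" "card I = l" for I
    proof -
      obtain X where X: "X \<subseteq> H" "I = g ` X"
        using I(1) by (meson subset_imageE)
      then have "card X = l"
        using I(2) inj card_image inj_on_subset by metis
      then have "c X = i"
        using X(1) H(2) c finite_subset unfolding nsets_def by blast
      then show ?thesis
        using X(2) by (auto simp: c_def split: if_splits)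
    qed
    show ?thesis
      using sub card_image[OF inj] H(3) colour by (intro exI[of _ "g ` H"]) auto
  qed
  then show ?thesis by blast
qed

lemma f_min_uneven_unbounded:
  assumes "1 \<le> l"
  shows "\<exists>M. \<forall>m\<ge>M. N \<le> f_min m {H :: 'b hypergraph. uneven_hypergraph l k H}"
proof -
  obtain M where M: "\<And>\<E> :: nat set set. \<lbrakk>finite \<E>; M \<le> card \<E>\<rbrakk> \<Longrightarrow> \<exists>E\<subseteq>\<E>. card E = N \<and>
    (\<forall>I J. I \<subseteq> E \<and> card I = l \<and> J \<subseteq> E \<and> card J = l \<longrightarrow> (\<Inter>I = {} \<longleftrightarrow> \<Inter>J = {}))"
    using Ramsey_empty_intersections[of N l] by metis
  have "N \<le> f_min m {H :: 'b hypergraph. uneven_hypergraph l k H}" if "M \<le> m" for m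
  proof (rule le_f_min)
    fix F :: "nat hypergraph"
    assume F: "wf_hypergraph F" "card (edges F) = m"
    obtain E where E: "E \<subseteq> edges F" "card E = N"
      and mono: "\<forall>I J. I \<subseteq> E \<and> card I = l \<and> J \<subseteq> E \<and> card J = l \<longrightarrow> (\<Inter>I = {} \<longleftrightarrow> \<Inter>J = {})"
      using M[OF finite_edges[OF F(1)]] F(2) \<open>M \<le> m\<close> by metis
    have "free_of {H :: 'b hypergraph. uneven_hypergraph l k H} (Hypergraph (verts F) E)"
      by (rule free_of_uneven_if_monochromatic[OF assms]) (use mono in \<open>unfold hypergraph.sel, blast\<close>)
    then show "N \<le> ex_num F {H :: 'b hypergraph. uneven_hypergraph l k H}"
      using card_le_ex_num[OF F(1) E(1)] E(2) by blast
  qed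
  then show ?thesis by blast
qed

section \<open>Even hypergraphs\<close>

lemma Inter_singletons_eq_empty_iff:
  assumes "I \<subseteq> range (\<lambda>i. {i})" and "card I \<ge> 1"
  shows "\<Inter>I = {} \<longleftrightarrow> card I \<noteq> 1"
proof (cases "card I = 1")
  case True
  then obtain A where "I = {A}" by (auto simp: card_1_singleton_iff)
  then show ?thesis using assms(1) by auto
next
  case False
  then obtain A B where "A \<in> I" "B \<in> I" "A \<noteq> B"
    using assms(2) by (metis card_le_Suc0_iff_eq card.infinite One_nat_def le_antisym not_one_le_zero)
  then have "A \<inter> B = {}" using assms(1) by auto
  then show ?thesis using False \<open>A \<in> I\<close> \<open>B \<in> I\<close> by blast
qed

lemma even_hypergraph_singletons:
  assumes "finite V" and "E \<subseteq> (\<lambda>i. {i}) ` V" and "card E = k"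
  shows "even_hypergraph k (Hypergraph V E)"
proof -
  have "\<Inter>I = {} \<longleftrightarrow> \<Inter>J = {}"
    if "I \<subseteq> E" "J \<subseteq> E" "card I = card J" "1 \<le> card I" for I J
  proof -
    have "I \<subseteq> range (\<lambda>i. {i})" "J \<subseteq> range (\<lambda>i. {i})"
      using that(1,2) assms(2) by auto
    then show ?thesis
      using that(3,4) Inter_singletons_eq_empty_iff[of I] Inter_singletons_eq_empty_iff[of J] by simp
  qed
  moreover have "wf_hypergraph (Hypergraph V E)"
    using assms unfolding wf_hypergraph_def by auto
  ultimately show ?thesis
    using assms(3) unfolding even_hypergraph_def by auto
qed

lemma even_hypergraphD: "even_hypergraph k H \<Longrightarrow> wf_hypergraph H \<and> card (edges H) = k"
  unfolding even_hypergraph_def by blast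

lemma f_min_even_le:
  assumes "0 < k"
  shows "f_min m {H :: nat hypergraph. even_hypergraph k H} \<le> k - 1"
proof -
  let ?F = "singleton_matching m"
  have "ex_num ?F {H :: nat hypergraph. even_hypergraph k H} \<le> k - 1"
  proof (rule ex_num_le[OF wf_singleton_matching assms])
    fix E
    assume E: "E \<subseteq> edges ?F"
      and free: "free_of {H :: nat hypergraph. even_hypergraph k H} (Hypergraph (verts ?F) E)"
    show "card E \<le> k - 1"
    proof (rule ccontr)
      assume "\<not> card E \<le> k - 1"
      then have "k \<le> card E" by simp
      then obtain E' where E': "E' \<subseteq> E" "card E' = k"
        using obtain_subset_with_card_n by metis
      have "even_hypergraph k (Hypergraph (verts ?F) E')"
        using E E' by (intro even_hypergraph_singletons) (auto simp: singleton_matching_def)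
      moreover have "contains_copy (Hypergraph (verts ?F) E) (Hypergraph (verts ?F) E')"
        unfolding contains_copy_def using E'(1) by (intro exI[of _ id]) auto
      ultimately show False
        using free unfolding free_of_def by simp
    qed
  qed (simp add: even_hypergraphD)
  then show ?thesis
    using f_min_le[OF wf_singleton_matching card_singleton_matching] le_trans by metis
qed

lemma le_f_min_even:
  assumes "0 < k" and "k - 1 \<le> m"
  shows "k - 1 \<le> f_min m {H :: 'b hypergraph. even_hypergraph k H}"
proof (rule le_f_min)
  fix F :: "nat hypergraph"
  assume F: "wf_hypergraph F" "card (edges F) = m"
  obtain E where E: "E \<subseteq> edges F" "card E = k - 1" "finite E"
    using obtain_subset_with_card_n[of "k - 1" "edges F"] F(2) assms(2) by auto
  have "free_of {H :: 'b hypergraph. even_hypergraph k H} (Hypergraph (verts F) E)"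
    using E assms(1) by (intro free_of_few_edges[of _ k]) (simp_all add: even_hypergraphD)
  then show "k - 1 \<le> ex_num F {H :: 'b hypergraph. even_hypergraph k H}"
    using card_le_ex_num[OF F(1) E(1)] E(2) by simp
qed

theorem theorem2p3:
  fixes k l :: nat
  assumes "1 \<le> l" and "l < k"
  shows "filterlim (\<lambda>m. f_min m {H :: nat hypergraph. uneven_hypergraph l k H}) at_top at_top
    \<and> (\<forall>m\<ge>k - 1. f_min m {H :: nat hypergraph. even_hypergraph k H} = k - 1)"
proof
  show "filterlim (\<lambda>m. f_min m {H :: nat hypergraph. uneven_hypergraph l k H}) at_top at_top"
    unfolding filterlim_at_top eventually_at_top_linorder
    using f_min_uneven_unbounded[OF assms(1)] by blast
  show "\<forall>m\<ge>k - 1. f_min m {H :: nat hypergraph. even_hypergraph k H} = k - 1"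
    using f_min_even_le[of k] le_f_min_even[of k, where 'b = nat] assms by (simp add: le_antisym)
qed

end
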